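(* Let $1<p\le n$. Let $\mathbf{X}$ be a deterministic $n\times p$ matrix with $\mathbf{X}^T\mathbf{X}=\mathbf{I}_p$, let $\boldsymbol\beta_0=(\beta_1,0,\dots,0)^T\in\mathbb{R}^p$ with $\beta_1\neq 0$, let $\sigma>0$, and let $\mathbf{y}=\mathbf{X}\boldsymbol\beta_0+\boldsymbol\varepsilon$ with $\varepsilon_1,\dots,\varepsilon_n$ i.i.d. $N(0,\sigma^2)$. Set $\mathbf z=\mathbf{X}^T\mathbf{y}$. For $\lambda\ge 0$ define $$L_p(\lambda)=\frac1n\Big(\beta_1-\operatorname{sgn}(z_1)(|z_1|-\lambda)_+\Big)^2+\frac1n\sum_{j=2}^p\big((|z_j|-\lambda)_+\big)^2,\qquad L_1(\lambda)=\frac1n\Big(\beta_1-\operatorname{sgn}(z_1)(|z_1|-\lambda)_+\Big)^2,$$ and $L_p(\lambda_p^* )=\min_{\lambda\ge0}L_p(\lambda)$, $L_1(\lambda_1^* )=\min_{\lambda\ge 0}L_1(\lambda)$. Then $$\Pr\Big(L_p(\lambda_p^* )>L_1(\lambda_1^* )\ \Big|\ \operatorname{sgn}(z_1)=\operatorname{sgn}(\beta_1)\Big)=1-\frac{1}{2p\,\Phi\!\left(\frac{|\beta_1|}{\sigma}\right)},$$ where $\Phi$ is the standard normal cumulative distribution function. (The paper writes the event as $L_p(\lambda_p^* )/L_1(\lambda_1^* )>1$.)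
   Context: $(a)_+=\max(a,0)$; $\operatorname{sgn}$ is the sign function. $L_p(\lambda)$ is the $L_2$ loss of the Lasso estimate $\hat\beta_{\lambda j}=\operatorname{sgn}(z_j)(|z_j|-\lambda)_+$ with all $p$ predictors and $L_1(\lambda)$ the loss using only the first (true) predictor. *)

theory Defs
  imports "HOL-Probability.Probability"
begin

text \<open>Indices are 0-based: observations i < n, predictors j < p; the true predictor is j = 0.\<close>

definition Phi :: "real \<Rightarrow> real" where
  "Phi x = measure (density lborel std_normal_density) {..x}"

definition soft_thr :: "real \<Rightarrow> real \<Rightarrow> real" where
  "soft_thr z lam = sgn z * max (\<bar>z\<bar> - lam) 0"

definition beta0 :: "real \<Rightarrow> nat \<Rightarrow> real" where
  "beta0 b1 k = (if k = 0 then b1 else 0)"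

definition yvec :: "(nat \<Rightarrow> nat \<Rightarrow> real) \<Rightarrow> nat \<Rightarrow> real \<Rightarrow> (nat \<Rightarrow> real) \<Rightarrow> nat \<Rightarrow> real" where
  "yvec X p b1 eps i = (\<Sum>k<p. X i k * beta0 b1 k) + eps i"

definition zvec :: "(nat \<Rightarrow> nat \<Rightarrow> real) \<Rightarrow> nat \<Rightarrow> nat \<Rightarrow> real \<Rightarrow> (nat \<Rightarrow> real) \<Rightarrow> nat \<Rightarrow> real" where
  "zvec X n p b1 eps j = (\<Sum>i<n. X i j * yvec X p b1 eps i)"

definition loss_p :: "nat \<Rightarrow> nat \<Rightarrow> real \<Rightarrow> (nat \<Rightarrow> real) \<Rightarrow> real \<Rightarrow> real" where
  "loss_p n p b1 z lam = (1 / real n) * (b1 - soft_thr (z 0) lam)\<^sup>2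
      + (1 / real n) * (\<Sum>j\<in>{1..<p}. (max (\<bar>z j\<bar> - lam) 0)\<^sup>2)"

definition loss_1 :: "nat \<Rightarrow> real \<Rightarrow> (nat \<Rightarrow> real) \<Rightarrow> real \<Rightarrow> real" where
  "loss_1 n b1 z lam = (1 / real n) * (b1 - soft_thr (z 0) lam)\<^sup>2"

text \<open>Minimal losses over lambda \<ge> 0 (the minimum is attained; we write the infimum).\<close>
definition min_loss_p :: "nat \<Rightarrow> nat \<Rightarrow> real \<Rightarrow> (nat \<Rightarrow> real) \<Rightarrow> real" where
  "min_loss_p n p b1 z = (INF lam\<in>{0..}. loss_p n p b1 z lam)"

definition min_loss_1 :: "nat \<Rightarrow> real \<Rightarrow> (nat \<Rightarrow> real) \<Rightarrow> real" where
  "min_loss_1 n b1 z = (INF lam\<in>{0..}. loss_1 n b1 z lam)"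

definition noise :: "nat \<Rightarrow> real \<Rightarrow> (nat \<Rightarrow> real) measure" where
  "noise n \<sigma> = PiM {..<n} (\<lambda>_. density lborel (normal_density 0 \<sigma>))"

end

theory Submission
  imports Defs
begin

text \<open>
  Put \<open>w\<^sub>j = (X\<^sup>T \<epsilon>)\<^sub>j\<close>, so that \<open>z\<^sub>0 = \<beta> + w\<^sub>0\<close> and \<open>z\<^sub>j = w\<^sub>j\<close> for \<open>j \<ge> 1\<close>, and let \<open>v = sgn \<beta> \<cdot> w\<^sub>0\<close>.
  When \<open>z\<^sub>0\<close> has the sign of \<open>\<beta>\<close>, i.e. \<open>v > - \<bar>\<beta>\<bar>\<close>, the one-predictor loss is minimised at \<open>\<lambda> = max v 0\<close>,
  the extra terms of the full loss decrease in \<open>\<lambda>\<close>, and any larger \<open>\<lambda>\<close> costs fit, so the two minima agree iff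
  \<open>\<bar>w\<^sub>j\<bar> \<le> max v 0\<close> for all \<open>j \<ge> 1\<close>. Almost surely this says that \<open>v \<ge> 0\<close> and that \<open>\<bar>w\<^sub>0\<bar>\<close> is the largest of
  the \<open>\<bar>w\<^sub>j\<bar>\<close>, an event of probability \<open>1 / (2p)\<close>.

  The last probability needs only symmetry: the reflection along the difference of two columns of \<open>X\<close>
  exchanges the corresponding \<open>w\<^sub>j\<close>, and it preserves the Gaussian measure, as one sees by
  conjugating it with planar reflections until it becomes a change of sign of one coordinate.
\<close>

subsection \<open>Comparison of the minimal losses\<close>

text \<open>Both minima are infima, so strictness needs a gap that is uniform in \<open>lam\<close>.
  If some \<open>\<bar>z j\<bar>\<close> exceeds the best threshold \<open>a\<close>, then every
  \<open>lam\<close> is either too small to remove that term or so far above \<open>a\<close> that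
  the fit of the first coordinate suffers; each alternative costs a fixed positive amount.\<close>

lemma min_loss_p_gt_min_loss_1_iff:
  assumes n: "n > 0" and b1: "b1 \<noteq> 0" and sgn: "sgn (z 0) = sgn b1"
  shows "min_loss_p n p b1 z > min_loss_1 n b1 z \<longleftrightarrow>
    \<not> (\<forall>j\<in>{1..<p}. \<bar>z j\<bar> \<le> max (\<bar>z 0\<bar> - \<bar>b1\<bar>) 0)"
proof -
  \<comment> \<open>Factoring out the common sign makes everything positive: \<open>a\<close> is the
    best threshold for the first coordinate alone, and \<open>q = u - a\<close> is the shrunken
    estimate of \<open>b\<close> that it yields.\<close>
  define u b q a where "u = \<bar>z 0\<bar>" and "b = \<bar>b1\<bar>" and "q = min u b" and "a = max (u - b) 0"
  have u: "u > 0" and b: "b > 0" using b1 sgn by (auto simp: u_def b_def sgn_0_0)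
  have sq: "(b1 - soft_thr (z 0) lam)\<^sup>2 = (b - max (u - lam) 0)\<^sup>2" for lam
  proof -
    have "b1 - soft_thr (z 0) lam = sgn b1 * (b - max (u - lam) 0)"
      by (simp add: soft_thr_def sgn u_def b_def right_diff_distrib mult_sgn_abs)
    moreover have "(sgn b1)\<^sup>2 = 1" using b1 by (simp add: sgn_if)
    ultimately show ?thesis by (simp add: power_mult_distrib)
  qed
  have q: "q > 0" "q \<le> b" "q \<le> u" "u - a = q" "a \<ge> 0" using u b by (auto simp: q_def a_def)
  have first: "(b - max (u - lam) 0)\<^sup>2 \<ge> (b - q)\<^sup>2" if "lam \<ge> 0" for lam
  proof (cases "u \<le> b")
    case True
    then have "q = u" by (simp add: q_def)
    then show ?thesis using that u q True by (intro power_mono) auto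
  qed (simp add: q_def)
  \<comment> \<open>Going \<open>d\<close> beyond \<open>a\<close> lowers the estimate by at least
    \<open>min d q\<close>, the cap \<open>q\<close> being there because shrinkage stops at 0.
    Expanding the square leaves a nonnegative cross term, since \<open>q \<le> b\<close>.\<close>
  have first_gap: "(b - max (u - lam) 0)\<^sup>2 \<ge> (b - q)\<^sup>2 + (min d q)\<^sup>2"
    if "lam \<ge> a + d" "d > 0" for lam d
  proof -
    have "b - max (u - lam) 0 \<ge> (b - q) + min d q" using that q by auto
    then have "(b - max (u - lam) 0)\<^sup>2 \<ge> ((b - q) + min d q)\<^sup>2"
      using q that by (intro power_mono) auto
    moreover have "((b - q) + min d q)\<^sup>2 = (b - q)\<^sup>2 + (min d q)\<^sup>2 + 2 * ((b - q) * min d q)"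
      by (simp add: power2_eq_square algebra_simps)
    moreover have "(b - q) * min d q \<ge> 0" using q that by simp
    ultimately show ?thesis by linarith
  qed
  have l1: "loss_1 n b1 z lam = (b - max (u - lam) 0)\<^sup>2 / n" for lam
    by (simp add: loss_1_def sq)
  have lp: "loss_p n p b1 z lam = loss_1 n b1 z lam + (\<Sum>j\<in>{1..<p}. (max (\<bar>z j\<bar> - lam) 0)\<^sup>2) / n" for lam
    by (simp add: loss_p_def loss_1_def)
  have l1a: "loss_1 n b1 z a = (b - q)\<^sup>2 / n" using q by (simp add: l1)
  have l1_ge: "loss_1 n b1 z a \<le> loss_1 n b1 z lam" if "lam \<ge> 0" for lam
    unfolding l1a unfolding l1 using first[OF that] by (simp add: divide_right_mono)
  have min1: "min_loss_1 n b1 z = loss_1 n b1 z a"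
    unfolding min_loss_1_def using l1_ge q(5)
    by (intro antisym cINF_lower cINF_greatest bdd_belowI2[where m="loss_1 n b1 z a"]) auto
  have lp_ge: "loss_p n p b1 z lam \<ge> loss_1 n b1 z lam" for lam
    unfolding lp by (simp add: sum_nonneg)
  show ?thesis
    unfolding u_def[symmetric] b_def[symmetric] a_def[symmetric]
  proof
    assume gt: "min_loss_1 n b1 z < min_loss_p n p b1 z"
    show "\<not> (\<forall>j\<in>{1..<p}. \<bar>z j\<bar> \<le> a)"
    proof
      assume all: "\<forall>j\<in>{1..<p}. \<bar>z j\<bar> \<le> a"
      have "min_loss_p n p b1 z \<le> loss_p n p b1 z a"
        unfolding min_loss_p_def using l1_ge lp_ge q(5)
        by (intro cINF_lower bdd_belowI2[where m="loss_1 n b1 z a"]) (auto intro: order_trans)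
      also have "\<dots> = loss_1 n b1 z a" using all by (simp add: lp)
      finally show False using gt min1 by simp
    qed
  next
    assume "\<not> (\<forall>j\<in>{1..<p}. \<bar>z j\<bar> \<le> a)"
    then obtain j where j: "j \<in> {1..<p}" "\<bar>z j\<bar> > a" by force
    \<comment> \<open>Half the excess of \<open>\<bar>z j\<bar>\<close> over \<open>a\<close>: for
      \<open>lam < a + d\<close> the \<open>j\<close>-th term is still larger than the square of
      \<open>d\<close>, and for \<open>lam \<ge> a + d\<close> the bound \<open>first_gap\<close>
      applies.\<close>
    define d where "d = (\<bar>z j\<bar> - a) / 2"
    have d: "d > 0" "\<bar>z j\<bar> = a + 2 * d" using j by (auto simp: d_def field_simps)
    have gap: "loss_p n p b1 z lam \<ge> ((b - q)\<^sup>2 + (min d q)\<^sup>2) / n" if "lam \<ge> 0" for lam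
    proof (cases "lam \<ge> a + d")
      case True
      then have "loss_1 n b1 z lam \<ge> ((b - q)\<^sup>2 + (min d q)\<^sup>2) / n"
        unfolding l1 using first_gap[OF True d(1)] by (intro divide_right_mono) auto
      then show ?thesis using lp_ge[of lam] by linarith
    next
      case False
      have "(min d q)\<^sup>2 \<le> (max (\<bar>z j\<bar> - lam) 0)\<^sup>2"
        using False d q by (intro power_mono) auto
      also have "\<dots> \<le> (\<Sum>j\<in>{1..<p}. (max (\<bar>z j\<bar> - lam) 0)\<^sup>2)"
        using j by (intro member_le_sum) auto
      finally have "(b - q)\<^sup>2 + (min d q)\<^sup>2 \<le>
          (b - max (u - lam) 0)\<^sup>2 + (\<Sum>j\<in>{1..<p}. (max (\<bar>z j\<bar> - lam) 0)\<^sup>2)"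
        using first[OF that] by linarith
      then show ?thesis
        unfolding lp l1 add_divide_distrib[symmetric] by (intro divide_right_mono) auto
    qed
    have "min_loss_1 n b1 z < ((b - q)\<^sup>2 + (min d q)\<^sup>2) / n"
      unfolding min1 l1a using n d q by (intro divide_strict_right_mono) auto
    also have "\<dots> \<le> min_loss_p n p b1 z"
      unfolding min_loss_p_def using gap by (intro cINF_greatest) auto
    finally show "min_loss_1 n b1 z < min_loss_p n p b1 z" .
  qed
qed

subsection \<open>Reflections preserve the Gaussian measure\<close>

text \<open>The product density depends only on the sum of squares, which the orthogonal map leaves
  unchanged.\<close>

lemma normal_density_reflect:
  assumes "c\<^sup>2 + s\<^sup>2 = 1"
  shows "normal_density 0 \<sigma> (c * z + s * y) * normal_density 0 \<sigma> (s * z - c * y)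
    = normal_density 0 \<sigma> z * normal_density 0 \<sigma> y"
proof -
  have "(c * z + s * y)\<^sup>2 + (s * z - c * y)\<^sup>2 = (c\<^sup>2 + s\<^sup>2) * (z\<^sup>2 + y\<^sup>2)"
    by (simp add: power2_eq_square algebra_simps)
  then have "(c * z + s * y)\<^sup>2 + (s * z - c * y)\<^sup>2 = z\<^sup>2 + y\<^sup>2" using assms by simp
  then have "exp (- (c * z + s * y)\<^sup>2 / (2 * \<sigma>\<^sup>2)) * exp (- (s * z - c * y)\<^sup>2 / (2 * \<sigma>\<^sup>2))
    = exp (- z\<^sup>2 / (2 * \<sigma>\<^sup>2)) * exp (- y\<^sup>2 / (2 * \<sigma>\<^sup>2))"
    unfolding exp_add[symmetric] add_divide_distrib[symmetric] by (smt (verit))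
  then show ?thesis
    by (simp add: normal_density_def mult.assoc mult.left_commute)
qed

definition gauss :: "real \<Rightarrow> real measure" where
  "gauss \<sigma> = density lborel (normal_density 0 \<sigma>)"

lemma sets_gauss [measurable_cong, simp]: "sets (gauss \<sigma>) = sets borel"
  by (simp add: gauss_def)

lemma space_gauss [simp]: "space (gauss \<sigma>) = UNIV"
  by (simp add: gauss_def)

lemma prob_space_gauss: "\<sigma> > 0 \<Longrightarrow> prob_space (gauss \<sigma>)"
  unfolding gauss_def by (rule prob_space_normal_density)

lemma nn_integral_gauss:
  fixes f :: "real \<Rightarrow> ennreal"
  shows "f \<in> borel_measurable borel \<Longrightarrow> integral\<^sup>N (gauss \<sigma>) f = (\<integral>\<^sup>+x. normal_density 0 \<sigma> x * f x \<partial>lborel)"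
  unfolding gauss_def by (subst nn_integral_density) auto

text \<open>The planar change of variables is done by two affine substitutions on the line, one in
  each variable, with Tonelli in between. Their factors \<open>\<bar>c\<bar>\<close> and
  \<open>1 / \<bar>c\<bar>\<close> cancel; division by \<open>c\<close> is the reason for
  \<open>c \<noteq> 0\<close>.\<close>

lemma nn_integral_gauss_reflect:
  assumes cs: "c\<^sup>2 + s\<^sup>2 = 1" and c: "c \<noteq> 0"
    and g [measurable]: "case_prod g \<in> borel_measurable (borel \<Otimes>\<^sub>M borel)"
  shows "(\<integral>\<^sup>+y. \<integral>\<^sup>+z. g (c * z + s * y) (s * z - c * y) \<partial>gauss \<sigma> \<partial>gauss \<sigma>)
    = (\<integral>\<^sup>+y. \<integral>\<^sup>+z. g z y \<partial>gauss \<sigma> \<partial>gauss \<sigma>)"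
proof -
  define \<phi> where "\<phi> = (\<lambda>x. ennreal (normal_density 0 \<sigma> x))"
  have [measurable]: "\<phi> \<in> borel_measurable borel" by (simp add: \<phi>_def)
  \<comment> \<open>With the invariant density absorbed into the integrand, the claim concerns
    Lebesgue measure only.\<close>
  define h where "h z y = \<phi> z * \<phi> y * g z y" for z y
  have h [measurable]: "case_prod h \<in> borel_measurable (borel \<Otimes>\<^sub>M borel)"
    unfolding h_def by measurable
  have \<phi>: "\<phi> (c * z + s * y) * \<phi> (s * z - c * y) = \<phi> z * \<phi> y" for z y
    using normal_density_reflect[OF cs, of \<sigma> z y]
    by (simp add: \<phi>_def ennreal_mult'[symmetric])
  have unfold: "(\<integral>\<^sup>+y. \<integral>\<^sup>+z. f z y \<partial>gauss \<sigma> \<partial>gauss \<sigma>)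
      = (\<integral>\<^sup>+y. \<integral>\<^sup>+z. \<phi> z * \<phi> y * f z y \<partial>lborel \<partial>lborel)"
    if [measurable]: "case_prod f \<in> borel_measurable (borel \<Otimes>\<^sub>M borel)" for f :: "real \<Rightarrow> real \<Rightarrow> ennreal"
    by (subst nn_integral_gauss)
       (auto simp: nn_integral_gauss \<phi>_def nn_integral_cmult[symmetric] mult_ac intro!: nn_integral_cong)
  have "(\<integral>\<^sup>+y. \<integral>\<^sup>+z. g (c * z + s * y) (s * z - c * y) \<partial>gauss \<sigma> \<partial>gauss \<sigma>)
      = (\<integral>\<^sup>+y. \<integral>\<^sup>+z. h (c * z + s * y) (s * z - c * y) \<partial>lborel \<partial>lborel)"
    by (subst unfold) (auto simp: h_def \<phi>)
  also have "\<dots> = (\<integral>\<^sup>+y. ennreal (1 / \<bar>c\<bar>) * (\<integral>\<^sup>+z. h z ((s * z - y) / c) \<partial>lborel) \<partial>lborel)"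
  proof (rule nn_integral_cong)
    fix y
    \<comment> \<open>The second new coordinate is expressed through the first one and the old
      \<open>y\<close>, so that for fixed \<open>y\<close> only \<open>z\<close> is
      substituted.\<close>
    have "s * (c * z + s * y) - y = c * (s * z - c * y)" for z
    proof -
      have "s * (c * z + s * y) - y = s * c * z + s\<^sup>2 * y - (c\<^sup>2 + s\<^sup>2) * y"
        unfolding cs by (simp add: algebra_simps power2_eq_square)
      then show ?thesis by (simp add: algebra_simps power2_eq_square)
    qed
    then have eq: "(s * (s * y + c * z) - y) / c = s * z - c * y" for z
      using c by (simp add: add.commute)
    have "(\<integral>\<^sup>+z. h z ((s * z - y) / c) \<partial>lborel)
        = \<bar>c\<bar> * (\<integral>\<^sup>+z. h (s * y + c * z) ((s * (s * y + c * z) - y) / c) \<partial>lborel)"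
      by (rule nn_integral_real_affine[OF _ c]) measurable
    also have "\<dots> = \<bar>c\<bar> * (\<integral>\<^sup>+z. h (c * z + s * y) (s * z - c * y) \<partial>lborel)"
      unfolding eq by (simp add: add.commute)
    finally show "(\<integral>\<^sup>+z. h (c * z + s * y) (s * z - c * y) \<partial>lborel)
        = ennreal (1 / \<bar>c\<bar>) * (\<integral>\<^sup>+z. h z ((s * z - y) / c) \<partial>lborel)"
      using c by (simp add: mult.assoc[symmetric] ennreal_mult'[symmetric])
  qed
  also have "\<dots> = ennreal (1 / \<bar>c\<bar>) * (\<integral>\<^sup>+y. \<integral>\<^sup>+z. h z ((s * z - y) / c) \<partial>lborel \<partial>lborel)"
    by (rule nn_integral_cmult) measurable
  also have "\<dots> = ennreal (1 / \<bar>c\<bar>) * (\<integral>\<^sup>+z. \<integral>\<^sup>+y. h z ((s * z - y) / c) \<partial>lborel \<partial>lborel)"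
    by (subst lborel_pair.Fubini') auto
  also have "\<dots> = (\<integral>\<^sup>+z. ennreal (1 / \<bar>c\<bar>) * (\<integral>\<^sup>+y. h z ((s * z - y) / c) \<partial>lborel) \<partial>lborel)"
    by (rule nn_integral_cmult[symmetric]) measurable
  also have "\<dots> = (\<integral>\<^sup>+z. \<integral>\<^sup>+y. h z y \<partial>lborel \<partial>lborel)"
  proof (rule nn_integral_cong)
    fix z
    have "(\<integral>\<^sup>+y. h z y \<partial>lborel) = \<bar>- 1 / c\<bar> * (\<integral>\<^sup>+y. h z (s * z / c + (- 1 / c) * y) \<partial>lborel)"
      using c by (intro nn_integral_real_affine) auto
    also have "(\<lambda>y. s * z / c + (- 1 / c) * y) = (\<lambda>y. (s * z - y) / c)"
      by (simp add: diff_divide_distrib)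
    finally show "ennreal (1 / \<bar>c\<bar>) * (\<integral>\<^sup>+y. h z ((s * z - y) / c) \<partial>lborel) = (\<integral>\<^sup>+y. h z y \<partial>lborel)"
      by (simp add: diff_divide_distrib)
  qed
  also have "\<dots> = (\<integral>\<^sup>+y. \<integral>\<^sup>+z. h z y \<partial>lborel \<partial>lborel)"
    by (subst lborel_pair.Fubini') auto
  also have "\<dots> = (\<integral>\<^sup>+y. \<integral>\<^sup>+z. g z y \<partial>gauss \<sigma> \<partial>gauss \<sigma>)"
    by (subst unfold[OF g]) (simp add: h_def)
  finally show ?thesis .
qed

section \<open>Measure-preserving maps\<close>

text \<open>Measurability is included because \<open>distr\<close> is meaningful as an image measure
  only for measurable maps.\<close>

definition preserves :: "'a measure \<Rightarrow> ('a \<Rightarrow> 'a) \<Rightarrow> bool" where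
  "preserves M T \<longleftrightarrow> T \<in> measurable M M \<and> distr M M T = M"

lemma preserves_comp:
  assumes "preserves M S" "preserves M T"
  shows "preserves M (\<lambda>x. S (T x))"
  using assms distr_distr[of S M M T M] by (auto simp: preserves_def comp_def)

lemma preserves_cong:
  assumes "\<And>x. x \<in> space M \<Longrightarrow> S x = T x"
  shows "preserves M S \<longleftrightarrow> preserves M T"
  using assms by (simp add: preserves_def cong: measurable_cong distr_cong)

lemma measure_preserves:
  assumes "preserves M T" "A \<in> sets M"
  shows "measure M (T -` A \<inter> space M) = measure M A"
  using assms measure_distr[of T M M A] by (simp add: preserves_def)

text \<open>The preimage of a box under a coordinatewise map is a box, and boxes determine the
  product measure. Used for changing the sign of one coordinate and of all coordinates.\<close>

lemma preserves_PiM: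
  assumes I: "finite I" and M: "\<And>i. prob_space (M i)"
    and f: "\<And>i. i \<in> I \<Longrightarrow> preserves (M i) (f i)"
  shows "preserves (PiM I M) (\<lambda>x. \<lambda>i\<in>I. f i (x i))"
  unfolding preserves_def
proof
  interpret product_prob_space M I using M by (simp add: product_prob_spaceI)
  have fm: "f i \<in> measurable (M i) (M i)" if "i \<in> I" for i
    using f[OF that] by (simp add: preserves_def)
  show T: "(\<lambda>x. \<lambda>i\<in>I. f i (x i)) \<in> measurable (PiM I M) (PiM I M)"
    using fm by (intro measurable_restrict measurable_PiM_component_rev) auto
  show "distr (PiM I M) (PiM I M) (\<lambda>x. \<lambda>i\<in>I. f i (x i)) = PiM I M"
  proof (rule PiM_eqI[OF I])
    fix A assume A: "\<And>i. i \<in> I \<Longrightarrow> A i \<in> sets (M i)"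
    have "emeasure (distr (PiM I M) (PiM I M) (\<lambda>x. \<lambda>i\<in>I. f i (x i))) (Pi\<^sub>E I A)
        = emeasure (PiM I M) (Pi\<^sub>E I (\<lambda>i. f i -` A i \<inter> space (M i)))"
      using A I by (subst emeasure_distr[OF T])
        (auto intro!: arg_cong[where f="emeasure (PiM I M)"] sets_PiM_I_finite simp: space_PiM PiE_iff extensional_def)
    also have "\<dots> = (\<Prod>i\<in>I. emeasure (M i) (f i -` A i \<inter> space (M i)))"
      using A fm by (intro emeasure_PiM I) (auto intro: measurable_sets)
    also have "\<dots> = (\<Prod>i\<in>I. emeasure (M i) (A i))"
    proof (intro prod.cong refl)
      fix i assume i: "i \<in> I"
      show "emeasure (M i) (f i -` A i \<inter> space (M i)) = emeasure (M i) (A i)"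
        using emeasure_distr[OF fm[OF i] A[OF i]] f[OF i] by (simp add: preserves_def)
    qed
    finally show "emeasure (distr (PiM I M) (PiM I M) (\<lambda>x. \<lambda>i\<in>I. f i (x i))) (Pi\<^sub>E I A)
      = (\<Prod>i\<in>I. emeasure (M i) (A i))" .
  qed simp
qed

lemma preserves_gauss_uminus: "preserves (gauss \<sigma>) uminus"
  unfolding preserves_def
proof
  show m: "uminus \<in> measurable (gauss \<sigma>) (gauss \<sigma>)" by measurable
  show "distr (gauss \<sigma>) (gauss \<sigma>) uminus = gauss \<sigma>"
  proof (rule measure_eqI)
    fix A assume "A \<in> sets (distr (gauss \<sigma>) (gauss \<sigma>) uminus)"
    then have A [measurable]: "A \<in> sets borel" by simp
    have "emeasure (distr (gauss \<sigma>) (gauss \<sigma>) uminus) A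
        = (\<integral>\<^sup>+x. indicator A x \<partial>distr (gauss \<sigma>) (gauss \<sigma>) uminus)" by simp
    also have "\<dots> = (\<integral>\<^sup>+x. normal_density 0 \<sigma> x * (indicator A (- x) :: ennreal) \<partial>lborel)"
      by (subst nn_integral_distr[OF m]) (auto simp: nn_integral_gauss)
    also have "\<dots> = (\<integral>\<^sup>+x. normal_density 0 \<sigma> x * (indicator A x :: ennreal) \<partial>lborel)"
      by (subst nn_integral_real_affine[where c="-1" and t=0]) (auto simp: normal_density_def)
    also have "\<dots> = emeasure (gauss \<sigma>) A"
      by (subst nn_integral_gauss[symmetric]) auto
    finally show "emeasure (distr (gauss \<sigma>) (gauss \<sigma>) uminus) A = emeasure (gauss \<sigma>) A" .
  qed simp
qed

section \<open>Planar reflections and reflections in hyperplanes\<close>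

abbreviation gauss_vec :: "'i set \<Rightarrow> real \<Rightarrow> ('i \<Rightarrow> real) measure" where
  "gauss_vec I \<sigma> \<equiv> PiM I (\<lambda>_. gauss \<sigma>)"

text \<open>The determinant is -1 when \<open>c\<^sup>2 + s\<^sup>2 = 1\<close>: this is a
  reflection of the plane of coordinates \<open>i\<close> and \<open>j\<close>, hence its own
  inverse, unlike the usual Givens rotation.\<close>

definition givens :: "'i \<Rightarrow> 'i \<Rightarrow> real \<Rightarrow> real \<Rightarrow> ('i \<Rightarrow> real) \<Rightarrow> 'i \<Rightarrow> real" where
  "givens i j c s x = x(i := c * x i + s * x j, j := s * x i - c * x j)"

lemma preserves_givens:
  assumes I: "finite I" "i \<in> I" "j \<in> I" "i \<noteq> j" and \<sigma>: "\<sigma> > 0"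
    and cs: "c\<^sup>2 + s\<^sup>2 = 1" "c \<noteq> 0"
  shows "preserves (gauss_vec I \<sigma>) (givens i j c s)"
  unfolding preserves_def
proof
  interpret prob_space "gauss \<sigma>" using \<sigma> by (rule prob_space_gauss)
  interpret product_sigma_finite "\<lambda>_::'a. gauss \<sigma>" by standard
  define K where "K = I - {i, j}"
  have K: "I = insert i (insert j K)" "finite K" "i \<notin> insert j K" "j \<notin> K"
    using I by (auto simp: K_def)
  show T [measurable]: "givens i j c s \<in> measurable (gauss_vec I \<sigma>) (gauss_vec I \<sigma>)"
  proof -
    have "(\<lambda>x. x(i := c * x i + s * x j, j := s * x i - c * x j)) \<in> measurable (gauss_vec I \<sigma>) (gauss_vec I \<sigma>)"
      using I by (intro measurable_fun_upd[where J=I]) (auto simp: insert_absorb)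
    then show ?thesis by (simp add: givens_def[abs_def])
  qed
  \<comment> \<open>Coordinates \<open>i\<close> and \<open>j\<close> are integrated innermost, so
    that the planar result applies with all other coordinates frozen.\<close>
  have split: "integral\<^sup>N (gauss_vec I \<sigma>) f
      = (\<integral>\<^sup>+x. \<integral>\<^sup>+y. \<integral>\<^sup>+z. f (x(j := y, i := z)) \<partial>gauss \<sigma> \<partial>gauss \<sigma> \<partial>gauss_vec K \<sigma>)"
    if [measurable]: "f \<in> borel_measurable (gauss_vec I \<sigma>)" for f
  proof -
    have f: "f \<in> borel_measurable (gauss_vec (insert i (insert j K)) \<sigma>)" using that K(1) by simp
    show ?thesis
      unfolding K(1)
      apply (subst product_nn_integral_insert[OF _ K(3) f])
       apply (simp add: K)
      apply (subst product_nn_integral_insert[OF K(2,4)])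
       apply (use f in measurable)
      done
  qed
  show "distr (gauss_vec I \<sigma>) (gauss_vec I \<sigma>) (givens i j c s) = gauss_vec I \<sigma>"
  proof (rule measure_eqI)
    fix A assume "A \<in> sets (distr (gauss_vec I \<sigma>) (gauss_vec I \<sigma>) (givens i j c s))"
    then have A [measurable]: "A \<in> sets (gauss_vec I \<sigma>)" by simp
    have "emeasure (distr (gauss_vec I \<sigma>) (gauss_vec I \<sigma>) (givens i j c s)) A
        = (\<integral>\<^sup>+x. indicator A (givens i j c s x) \<partial>gauss_vec I \<sigma>)"
      using nn_integral_distr[OF T, of "indicator A"] by simp
    also have "\<dots> = (\<integral>\<^sup>+x. \<integral>\<^sup>+y. \<integral>\<^sup>+z. indicator A (givens i j c s (x(j := y, i := z))) \<partial>gauss \<sigma> \<partial>gauss \<sigma> \<partial>gauss_vec K \<sigma>)"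
      by (subst split) auto
    also have "\<dots> = (\<integral>\<^sup>+x. \<integral>\<^sup>+y. \<integral>\<^sup>+z. indicator A (x(j := y, i := z)) \<partial>gauss \<sigma> \<partial>gauss \<sigma> \<partial>gauss_vec K \<sigma>)"
    proof (rule nn_integral_cong)
      fix x assume x: "x \<in> space (gauss_vec K \<sigma>)"
      define g :: "real \<Rightarrow> real \<Rightarrow> ennreal" where "g z y = indicator A (x(j := y, i := z))" for z y
      have "(\<lambda>p. x(j := snd p, i := fst p)) \<in> measurable (borel \<Otimes>\<^sub>M borel) (gauss_vec I \<sigma>)"
        using x K by (intro measurable_fun_upd[where J="insert j K"] measurable_fun_upd[where J=K]) auto
      then have g: "case_prod g \<in> borel_measurable (borel \<Otimes>\<^sub>M borel)"
        unfolding g_def by (simp add: split_beta')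
      have "givens i j c s (x(j := y, i := z)) = x(j := s * z - c * y, i := c * z + s * y)" for y z
        using I(4) by (auto simp: givens_def fun_eq_iff)
      then show "(\<integral>\<^sup>+y. \<integral>\<^sup>+z. indicator A (givens i j c s (x(j := y, i := z))) \<partial>gauss \<sigma> \<partial>gauss \<sigma>)
        = (\<integral>\<^sup>+y. \<integral>\<^sup>+z. indicator A (x(j := y, i := z)) \<partial>gauss \<sigma> \<partial>gauss \<sigma>)"
        using nn_integral_gauss_reflect[OF cs g] by (simp add: g_def)
    qed
    also have "\<dots> = emeasure (gauss_vec I \<sigma>) A"
      by (subst split[symmetric]) auto
    finally show "emeasure (distr (gauss_vec I \<sigma>) (gauss_vec I \<sigma>) (givens i j c s)) A = emeasure (gauss_vec I \<sigma>) A" .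
  qed simp
qed

lemma sum_remove2:
  fixes f :: "'i \<Rightarrow> real"
  assumes "finite I" "i \<in> I" "j \<in> I" "i \<noteq> j"
  shows "sum f I = f i + f j + sum f (I - {i, j})"
proof -
  have "sum f I = f i + sum f (I - {i})" using assms by (intro sum.remove) auto
  also have "sum f (I - {i}) = f j + sum f (I - {i} - {j})" using assms by (intro sum.remove) auto
  also have "I - {i} - {j} = I - {i, j}" by auto
  finally show ?thesis by simp
qed

text \<open>Normalised for \<open>|u|\<^sup>2 = 2\<close>, which is the norm of a difference of two orthonormal vectors.\<close>

definition reflect :: "'i set \<Rightarrow> ('i \<Rightarrow> real) \<Rightarrow> ('i \<Rightarrow> real) \<Rightarrow> 'i \<Rightarrow> real" where
  "reflect I u x = (\<lambda>i\<in>I. x i - (\<Sum>k\<in>I. u k * x k) * u i)"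

text \<open>Induction on the number of nonzero coordinates of \<open>u\<close>. A planar reflection
  merges two of them into one, and conjugating by it turns the reflection along \<open>u\<close>
  into one along a sparser vector of the same norm. With a single nonzero coordinate left, the map
  is a sign change.\<close>

lemma preserves_reflect:
  assumes I: "finite I" and \<sigma>: "\<sigma> > 0" and u: "(\<Sum>i\<in>I. (u i)\<^sup>2) = 2"
  shows "preserves (gauss_vec I \<sigma>) (reflect I u)"
  using u
proof (induction "card {i\<in>I. u i \<noteq> 0}" arbitrary: u rule: less_induct)
  case less
  show ?case
  proof (cases "\<exists>i\<in>I. \<exists>j\<in>I. i \<noteq> j \<and> u i \<noteq> 0 \<and> u j \<noteq> 0")
    case True
    then obtain i j where ij: "i \<in> I" "j \<in> I" "i \<noteq> j" "u i \<noteq> 0" "u j \<noteq> 0" by blast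
    define r where "r = sqrt ((u i)\<^sup>2 + (u j)\<^sup>2)"
    have r: "r > 0" "r\<^sup>2 = (u i)\<^sup>2 + (u j)\<^sup>2" using ij by (auto simp: r_def sum_power2_gt_zero_iff)
    define c s where "c = u i / r" and "s = u j / r"
    have cs: "c\<^sup>2 + s\<^sup>2 = 1" "c \<noteq> 0" "u i = c * r" "u j = s * r"
      using r ij by (auto simp: c_def s_def power_divide add_divide_distrib[symmetric])
    \<comment> \<open>\<open>v\<close> is the image of \<open>u\<close> under
      \<open>givens i j c s\<close>: by the choice of \<open>c\<close> and \<open>s\<close>, the
      pair \<open>(u i, u j)\<close> goes to \<open>(r, 0)\<close>.\<close>
    define v where "v = u(i := r, j := 0)"
    have v: "v i = r" "v j = 0" "\<And>k. k \<noteq> i \<Longrightarrow> k \<noteq> j \<Longrightarrow> v k = u k"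
      using ij by (auto simp: v_def)
    have "(\<Sum>i\<in>I. (v i)\<^sup>2) = r\<^sup>2 + (\<Sum>k\<in>I - {i, j}. (v k)\<^sup>2)"
      using sum_remove2[OF I ij(1-3), of "\<lambda>k. (v k)\<^sup>2"] v by simp
    also have "(\<Sum>k\<in>I - {i, j}. (v k)\<^sup>2) = (\<Sum>k\<in>I - {i, j}. (u k)\<^sup>2)"
      by (intro sum.cong) (auto simp: v)
    also have "r\<^sup>2 + \<dots> = 2"
      using sum_remove2[OF I ij(1-3), of "\<lambda>k. (u k)\<^sup>2"] less.prems r by simp
    finally have v2: "(\<Sum>i\<in>I. (v i)\<^sup>2) = 2" .
    have "{k\<in>I. v k \<noteq> 0} \<subset> {k\<in>I. u k \<noteq> 0}"
      using ij v(2) by (auto simp: v_def)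
    then have "card {k\<in>I. v k \<noteq> 0} < card {k\<in>I. u k \<noteq> 0}"
      using I by (intro psubset_card_mono) auto
    then have pv: "preserves (gauss_vec I \<sigma>) (reflect I v)" using v2 less.hyps by blast
    have pg: "preserves (gauss_vec I \<sigma>) (givens i j c s)"
      using preserves_givens[OF I ij(1-3) \<sigma> cs(1,2)] .
    have "reflect I u x = givens i j c s (reflect I v (givens i j c s x))"
      if x: "x \<in> space (gauss_vec I \<sigma>)" for x
    proof -
      let ?g = "givens i j c s x"
      have g: "?g i = c * x i + s * x j" "?g j = s * x i - c * x j"
        "\<And>k. k \<noteq> i \<Longrightarrow> k \<noteq> j \<Longrightarrow> ?g k = x k"
        using ij by (auto simp: givens_def)
      \<comment> \<open>The planar map keeps inner products, so both reflections subtract the same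
        multiple of their respective vectors.\<close>
      have "(\<Sum>k\<in>I. v k * ?g k) = r * (c * x i + s * x j) + (\<Sum>k\<in>I - {i, j}. v k * ?g k)"
        using sum_remove2[OF I ij(1-3), of "\<lambda>k. v k * ?g k"] v g by simp
      also have "(\<Sum>k\<in>I - {i, j}. v k * ?g k) = (\<Sum>k\<in>I - {i, j}. u k * x k)"
        by (intro sum.cong) (auto simp: v g)
      also have "r * (c * x i + s * x j) + \<dots> = (\<Sum>k\<in>I. u k * x k)"
        using sum_remove2[OF I ij(1-3), of "\<lambda>k. u k * x k"] cs(3,4) by (simp add: algebra_simps)
      finally have a: "(\<Sum>k\<in>I. v k * ?g k) = (\<Sum>k\<in>I. u k * x k)" .
      define a where "a = (\<Sum>k\<in>I. u k * x k)"
      have R: "reflect I v ?g = (\<lambda>k\<in>I. ?g k - a * v k)"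
        unfolding reflect_def a a_def ..
      \<comment> \<open>This is the involution property, which recovers \<open>x\<close> when
        \<open>givens\<close> is applied a second time.\<close>
      have e1: "c * (c * t) + s * (s * t) = t" for t
      proof -
        have "c * (c * t) + s * (s * t) = (c\<^sup>2 + s\<^sup>2) * t" by (simp add: power2_eq_square algebra_simps)
        then show ?thesis using cs by simp
      qed
      show ?thesis
      proof
        fix k
        consider "k = i" | "k = j" | "k \<noteq> i" "k \<noteq> j" "k \<in> I" | "k \<notin> I" by blast
        then show "reflect I u x k = givens i j c s (reflect I v ?g) k"
        proof cases
          case 1
          have "reflect I u x i = x i - a * u i" using ij by (simp add: reflect_def a_def)
          also have "\<dots> = c * (?g i - a * v i) + s * (?g j - a * v j)"
            unfolding g(1,2) v(1,2) cs(3) using e1[of "x i"] by (simp add: algebra_simps)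
          finally show ?thesis using 1 ij unfolding R by (simp add: givens_def)
        next
          case 2
          have "reflect I u x j = x j - a * u j" using ij by (simp add: reflect_def a_def)
          also have "\<dots> = s * (?g i - a * v i) - c * (?g j - a * v j)"
            unfolding g(1,2) v(1,2) cs(4) using e1[of "x j"] by (simp add: algebra_simps)
          finally show ?thesis using 2 ij unfolding R by (simp add: givens_def)
        next
          case 3
          then show ?thesis
            unfolding R using v g
            by (simp add: reflect_def a_def[symmetric] givens_def[of i j c s "\<lambda>k\<in>I. ?g k - a * v k"])
        next
          case 4
          then show ?thesis
            unfolding R using ij
            by (auto simp: reflect_def givens_def[of i j c s "\<lambda>k\<in>I. ?g k - a * v k"])
        qed
      qed
    qed
    then have "preserves (gauss_vec I \<sigma>) (reflect I u) \<longleftrightarrow>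
      preserves (gauss_vec I \<sigma>) (\<lambda>x. givens i j c s (reflect I v (givens i j c s x)))"
      by (rule preserves_cong)
    then show ?thesis using preserves_comp[OF pg preserves_comp[OF pv pg]] by simp
  next
    case False
    have "\<exists>i\<in>I. u i \<noteq> 0"
      by (rule ccontr) (use less.prems in simp)
    then obtain i where i: "i \<in> I" "u i \<noteq> 0" by blast
    with False have 0: "u k = 0" if "k \<in> I" "k \<noteq> i" for k using that by blast
    have "(u i)\<^sup>2 = (\<Sum>k\<in>I. (u k)\<^sup>2)"
      using I i 0 by (subst sum.remove[of I i]) auto
    \<comment> \<open>Since the one remaining entry has square 2, \<open>x i\<close> is sent to
      \<open>x i - 2 * x i\<close>.\<close>
    then have ui: "u i * u i = 2" using less.prems by (simp add: power2_eq_square)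
    have "(\<Sum>k\<in>I. u k * x k) = u i * x i" for x :: "'a \<Rightarrow> real"
      using I i 0 by (subst sum.remove[of I i]) auto
    then have "reflect I u x = (\<lambda>k\<in>I. (if k = i then uminus else (\<lambda>y. y)) (x k))" for x
      using ui 0 by (auto simp: reflect_def fun_eq_iff)
    then have "reflect I u = (\<lambda>x. \<lambda>k\<in>I. (if k = i then uminus else (\<lambda>y. y)) (x k))" by blast
    moreover have "preserves (gauss_vec I \<sigma>) (\<lambda>x. \<lambda>k\<in>I. (if k = i then uminus else (\<lambda>y. y)) (x k))"
    proof (rule preserves_PiM[OF I])
      show "preserves (gauss \<sigma>) (if k = i then uminus else (\<lambda>y. y))" for k
        using preserves_gauss_uminus[of \<sigma>] distr_id[of "gauss \<sigma>"] by (auto simp: preserves_def id_def)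
    qed (rule prob_space_gauss[OF \<sigma>])
    ultimately show ?thesis by simp
  qed
qed

subsection \<open>Linear forms of a Gaussian vector\<close>

definition lin :: "'i set \<Rightarrow> ('i \<Rightarrow> real) \<Rightarrow> ('i \<Rightarrow> real) \<Rightarrow> real" where
  "lin I a x = (\<Sum>i\<in>I. a i * x i)"

lemma measurable_lin [measurable]: "lin I a \<in> borel_measurable (PiM I (\<lambda>_. borel))"
  unfolding lin_def[abs_def] by measurable

lemma lin_diff: "lin I (\<lambda>i. a i - b i) x = lin I a x - lin I b x"
  by (simp add: lin_def algebra_simps sum_subtractf)

lemma lin_diff_right: "lin I a (\<lambda>i. x i - y i) = lin I a x - lin I a y"
  by (simp add: lin_def algebra_simps sum_subtractf)

lemma lin_add: "lin I (\<lambda>i. a i + b i) x = lin I a x + lin I b x"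
  by (simp add: lin_def algebra_simps sum.distrib)

lemma lin_add_right: "lin I a (\<lambda>i. x i + y i) = lin I a x + lin I a y"
  by (simp add: lin_def algebra_simps sum.distrib)

lemma lin_reflect: "lin I a (reflect I u x) = lin I a x - lin I u x * lin I a u"
proof -
  have "lin I a (reflect I u x) = (\<Sum>i\<in>I. a i * x i - lin I u x * (a i * u i))"
    unfolding lin_def[of I a] reflect_def lin_def[of I u x, symmetric]
    by (intro sum.cong) (auto simp: algebra_simps)
  then show ?thesis by (simp add: sum_subtractf sum_distrib_left[symmetric] lin_def[of I a])
qed

lemma pred_le_real [measurable (raw)]:
  fixes f g :: "'a \<Rightarrow> real"
  assumes [measurable]: "f \<in> borel_measurable M" "g \<in> borel_measurable M"
  shows "Measurable.pred M (\<lambda>x. f x \<le> g x)"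
  unfolding not_less[symmetric] by measurable

text \<open>The coordinates are independent, and a sum of independent normal variables is normal
  with the variances added.\<close>

lemma distributed_lin:
  fixes a :: "'i \<Rightarrow> real"
  assumes I: "finite I" and \<sigma>: "\<sigma> > 0" and a: "lin I a a > 0"
  shows "distributed (gauss_vec I \<sigma>) lborel (lin I a) (normal_density 0 (\<sigma> * sqrt (lin I a a)))"
proof -
  interpret product_prob_space "\<lambda>_. gauss \<sigma>" I
    using prob_space_gauss[OF \<sigma>] by (simp add: product_prob_spaceI)
  \<comment> \<open>Terms with coefficient 0 are constant and have no density, so they are dropped
    before the sum rule for normal variables is applied.\<close>
  define J where "J = {i\<in>I. a i \<noteq> 0}"
  have J: "finite J" "J \<subseteq> I" using I by (auto simp: J_def)
  have "J \<noteq> {}"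
  proof
    assume "J = {}"
    then have "lin I a a = 0" unfolding lin_def by (intro sum.neutral) (auto simp: J_def)
    then show False using a by simp
  qed
  then have "I \<noteq> {}" using J by auto
  \<comment> \<open>Independence of the projections amounts to their joint law, here the identity
    image, being the product of their marginals.\<close>
  have "distr (gauss_vec I \<sigma>) (gauss_vec I \<sigma>) (\<lambda>x. \<lambda>i\<in>I. x i) = gauss_vec I \<sigma>"
  proof -
    have "distr (gauss_vec I \<sigma>) (gauss_vec I \<sigma>) (\<lambda>x. \<lambda>i\<in>I. x i)
        = distr (gauss_vec I \<sigma>) (gauss_vec I \<sigma>) (\<lambda>x. x)"
      by (intro distr_cong) (auto simp: space_PiM)
    then show ?thesis by (simp add: distr_id2)
  qed
  moreover have "PiM I (\<lambda>i. distr (gauss_vec I \<sigma>) (gauss \<sigma>) (\<lambda>x. x i)) = gauss_vec I \<sigma>"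
    by (intro PiM_cong refl) (simp add: PiM_component)
  ultimately have "P.indep_vars (\<lambda>_. gauss \<sigma>) (\<lambda>i x. x i) I"
    using \<open>I \<noteq> {}\<close> by (subst P.indep_vars_iff_distr_eq_PiM') auto
  then have ind: "P.indep_vars (\<lambda>_. gauss \<sigma>) (\<lambda>i x. x i) J"
    using J(2) by (rule P.indep_vars_subset)
  have ind: "P.indep_vars (\<lambda>_. borel) (\<lambda>i x. a i * x i) J"
    by (rule P.indep_vars_compose2[OF ind]) simp
  have "distributed (gauss_vec I \<sigma>) lborel (\<lambda>x. a i * x i) (normal_density 0 (\<bar>a i\<bar> * \<sigma>))"
    if i: "i \<in> J" for i
  proof -
    have "distr (gauss_vec I \<sigma>) lborel (\<lambda>x. x i) = gauss \<sigma>"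
      using PiM_component[of i] i J by (auto cong: distr_cong simp: distr_cong[OF refl sets_gauss])
    then have "distributed (gauss_vec I \<sigma>) lborel (\<lambda>x. x i) (normal_density 0 \<sigma>)"
      using i J by (auto simp: distributed_def gauss_def)
    from P.normal_density_affine[OF this \<sigma>, of "a i" 0] show ?thesis
      using i by (simp add: J_def)
  qed
  then have "distributed (gauss_vec I \<sigma>) lborel (\<lambda>x. \<Sum>i\<in>J. a i * x i)
      (normal_density (\<Sum>i\<in>J. 0) (sqrt (\<Sum>i\<in>J. (\<bar>a i\<bar> * \<sigma>)\<^sup>2)))"
    using J \<open>J \<noteq> {}\<close> \<sigma> ind by (intro P.sum_indep_normal) (auto simp: J_def)
  moreover have "(\<Sum>i\<in>J. a i * x i) = lin I a x" for x
    unfolding lin_def using I by (intro sum.mono_neutral_left) (auto simp: J_def)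
  moreover have "(\<Sum>i\<in>J. (\<bar>a i\<bar> * \<sigma>)\<^sup>2) = \<sigma>\<^sup>2 * lin I a a"
  proof -
    have "(\<Sum>i\<in>J. (\<bar>a i\<bar> * \<sigma>)\<^sup>2) = (\<Sum>i\<in>I. (\<bar>a i\<bar> * \<sigma>)\<^sup>2)"
      using I by (intro sum.mono_neutral_left) (auto simp: J_def)
    then show ?thesis
      by (simp add: lin_def sum_distrib_left mult_ac power2_eq_square)
  qed
  ultimately show ?thesis
    using \<sigma> by (simp add: real_sqrt_mult)
qed

text \<open>The form has a density, so it gives no mass to a single point.\<close>

lemma AE_lin_neq_0:
  assumes "finite I" "\<sigma> > 0" "lin I a a > 0"
  shows "AE x in gauss_vec I \<sigma>. lin I a x \<noteq> 0"
proof -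
  note D = distributed_lin[OF assms]
  have "AE y in lborel. y \<noteq> (0::real)" by (rule AE_lborel_singleton)
  then have "AE y in distr (gauss_vec I \<sigma>) lborel (lin I a). y \<noteq> 0"
    unfolding distributed_distr_eq_density[OF D]
    by (subst AE_density) (auto simp: distributed_borel_measurable[OF D])
  then show ?thesis by (rule AE_distrD[OF distributed_measurable[OF D]])
qed

section \<open>Probability that a given form dominates\<close>

text \<open>Some form always has the largest absolute value, and almost surely only one does. By
  symmetry the \<open>p\<close> candidates are equally likely.\<close>

lemma prob_dominant_lin:
  fixes p k :: nat
  assumes I: "finite I" and \<sigma>: "\<sigma> > 0"
    and orth: "\<And>j k. j < p \<Longrightarrow> k < p \<Longrightarrow> lin I (a j) (a k) = (if j = k then 1 else 0)"
    and k: "k < p"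
  shows "measure (gauss_vec I \<sigma>) {x \<in> space (gauss_vec I \<sigma>). \<forall>j<p. \<bar>lin I (a j) x\<bar> \<le> \<bar>lin I (a k) x\<bar>} = 1 / p"
proof -
  let ?N = "gauss_vec I \<sigma>"
  interpret N: prob_space ?N using prob_space_gauss[OF \<sigma>] by (intro prob_space_PiM)
  define w where "w j x = lin I (a j) x" for j x
  have [measurable]: "w j \<in> borel_measurable (PiM I (\<lambda>_. borel))" for j by (simp add: w_def[abs_def])
  define E where "E k = {x \<in> space ?N. \<forall>j<p. \<bar>w j x\<bar> \<le> \<bar>w k x\<bar>}" for k
  have E [measurable]: "E k \<in> sets ?N" for k unfolding E_def by measurable
  have eq: "measure ?N (E l) = measure ?N (E k)" if l: "l < p" "l \<noteq> k" for l
  proof -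
    \<comment> \<open>The difference of two orthonormal vectors has squared norm 2, and reflecting
      along it exchanges them while fixing every vector orthogonal to both.\<close>
    define u where "u = (\<lambda>i. a k i - a l i)"
    have wu: "lin I (a j) u = (if j = k then 1 else if j = l then -1 else 0)" if "j < p" for j
      using that k l by (auto simp: u_def lin_diff_right orth)
    have "lin I u u = 2" using k l
      by (subst (1) u_def) (simp add: lin_diff wu)
    then have "(\<Sum>i\<in>I. (u i)\<^sup>2) = 2" by (simp add: lin_def power2_eq_square)
    then have R: "preserves ?N (reflect I u)" by (rule preserves_reflect[OF I \<sigma>])
    have swap: "w j (reflect I u x) = (if j = k then w l x else if j = l then w k x else w j x)"
      if "j < p" for j x
      using that l(2) by (auto simp: w_def lin_reflect wu) (simp_all add: u_def lin_diff)
    have "(\<forall>j<p. \<bar>w j (reflect I u x)\<bar> \<le> \<bar>w k (reflect I u x)\<bar>) \<longleftrightarrow> (\<forall>j<p. \<bar>w j x\<bar> \<le> \<bar>w l x\<bar>)" for x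
    proof -
      have "w l (reflect I u x) = w k x" "w k (reflect I u x) = w l x" using k l by (auto simp: swap)
      moreover have "w j (reflect I u x) = w j x" if "j < p" "j \<noteq> k" "j \<noteq> l" for j
        using that by (simp add: swap)
      ultimately show ?thesis using k l(1) by (metis order_refl)
    qed
    then have "E l = reflect I u -` E k \<inter> space ?N"
      using measurable_space[of "reflect I u" ?N ?N] R by (auto simp: E_def preserves_def)
    then show ?thesis using measure_preserves[OF R E] by simp
  qed
  have tie: "AE x in ?N. \<bar>w j x\<bar> \<noteq> \<bar>w l x\<bar>" if jl: "j < p" "l < p" "j \<noteq> l" for j l
  proof -
    \<comment> \<open>A tie in absolute value means that the difference or the sum of the two forms
      vanishes; both have coefficient vectors of squared norm 2.\<close>
    have "AE x in ?N. lin I (\<lambda>i. a j i - a l i) x \<noteq> 0" "AE x in ?N. lin I (\<lambda>i. a j i + a l i) x \<noteq> 0"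
      using jl by (intro AE_lin_neq_0 I \<sigma>; simp add: lin_diff lin_diff_right lin_add lin_add_right orth)+
    then show ?thesis by eventually_elim (auto simp: w_def lin_diff lin_add abs_if split: if_splits)
  qed
  have "AE x in ?N. \<forall>j\<in>{..<p}. \<forall>l\<in>{..<p}. j \<noteq> l \<longrightarrow> \<bar>w j x\<bar> \<noteq> \<bar>w l x\<bar>"
    using tie by (auto simp: AE_ball_countable)
  then have "AE x in ?N. \<exists>!m\<in>{..<p}. \<forall>j<p. \<bar>w j x\<bar> \<le> \<bar>w m x\<bar>"
  proof eventually_elim
    case (elim x)
    let ?V = "(\<lambda>j. \<bar>w j x\<bar>) ` {..<p}"
    have "Max ?V \<in> ?V" using k by (intro Max_in) auto
    then obtain m where m: "m < p" "Max ?V = \<bar>w m x\<bar>" by auto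
    have max: "\<bar>w j x\<bar> \<le> \<bar>w m x\<bar>" if "j < p" for j
      unfolding m(2)[symmetric] using that by (intro Max_ge) auto
    show ?case
    proof (rule ex1I[of _ m])
      fix m' assume m': "m' \<in> {..<p} \<and> (\<forall>j<p. \<bar>w j x\<bar> \<le> \<bar>w m' x\<bar>)"
      then have "\<bar>w m' x\<bar> = \<bar>w m x\<bar>" using m max by (intro antisym) auto
      then show "m' = m" using elim m m' by auto
    qed (use m max in auto)
  qed
  then have "N.prob {x \<in> space ?N. True} = (\<Sum>m<p. N.prob {x \<in> space ?N. \<forall>j<p. \<bar>w j x\<bar> \<le> \<bar>w m x\<bar>})"
    using E by (intro N.prob_sum) (auto simp: E_def)
  also have "\<dots> = (\<Sum>m<p. N.prob (E k))"
    using eq by (intro sum.cong) (auto simp: E_def[symmetric] dest: eq)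
  finally have "p * N.prob (E k) = 1" by (simp add: N.prob_space)
  then show ?thesis using k by (simp add: E_def w_def field_simps)
qed

text \<open>Negating the whole vector preserves the measure and the dominance event but flips the
  sign of the form. As the form is almost surely nonzero, each sign takes half of
  \<open>1 / p\<close>.\<close>

lemma prob_dominant_lin_signed:
  fixes p k :: nat
  assumes I: "finite I" and \<sigma>: "\<sigma> > 0"
    and orth: "\<And>j k. j < p \<Longrightarrow> k < p \<Longrightarrow> lin I (a j) (a k) = (if j = k then 1 else 0)"
    and k: "k < p" and s: "s \<noteq> 0"
  shows "measure (gauss_vec I \<sigma>) {x \<in> space (gauss_vec I \<sigma>). 0 \<le> s * lin I (a k) x \<and>
    (\<forall>j<p. \<bar>lin I (a j) x\<bar> \<le> \<bar>lin I (a k) x\<bar>)} = 1 / (2 * p)"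
proof -
  let ?N = "gauss_vec I \<sigma>"
  interpret N: prob_space ?N using prob_space_gauss[OF \<sigma>] by (intro prob_space_PiM)
  define D where "D x \<longleftrightarrow> (\<forall>j<p. \<bar>lin I (a j) x\<bar> \<le> \<bar>lin I (a k) x\<bar>)" for x
  have [measurable]: "Measurable.pred ?N D" unfolding D_def[abs_def] by measurable
  define E where "E t = {x \<in> space ?N. 0 \<le> t * lin I (a k) x \<and> D x}" for t :: real
  have E [measurable]: "E t \<in> sets ?N" for t unfolding E_def by measurable
  have neg: "preserves ?N (\<lambda>x. \<lambda>i\<in>I. - x i)"
    using preserves_PiM[OF I prob_space_gauss[OF \<sigma>] preserves_gauss_uminus] .
  have "lin I b (\<lambda>i\<in>I. - x i) = - lin I b x" for b x
    by (simp add: lin_def sum_negf cong: sum.cong)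
  then have "E (- s) = (\<lambda>x. \<lambda>i\<in>I. - x i) -` E s \<inter> space ?N"
    using measurable_space[of "\<lambda>x. \<lambda>i\<in>I. - x i" ?N ?N] neg by (auto simp: E_def D_def preserves_def)
  then have eq: "N.prob (E (- s)) = N.prob (E s)" using measure_preserves[OF neg E] by simp
  have "AE x in ?N. lin I (a k) x \<noteq> 0" using k by (intro AE_lin_neq_0 I \<sigma>) (simp add: orth)
  then have "AE x in ?N. (\<forall>t\<in>{s, - s}. 0 \<le> t * lin I (a k) x \<and> D x \<longrightarrow> D x) \<and>
      (D x \<longrightarrow> (\<exists>!t\<in>{s, - s}. 0 \<le> t * lin I (a k) x \<and> D x))"
  proof eventually_elim
    case (elim x)
    have "s * lin I (a k) x \<noteq> 0" using elim s by simp
    then consider "s * lin I (a k) x > 0" | "s * lin I (a k) x < 0" by linarith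
    then show ?case by cases auto
  qed
  then have "N.prob {x \<in> space ?N. D x} = (\<Sum>t\<in>{s, - s}. N.prob {x \<in> space ?N. 0 \<le> t * lin I (a k) x \<and> D x})"
    by (intro N.prob_sum) auto
  also have "\<dots> = 2 * N.prob (E s)" using s eq by (simp add: E_def[symmetric])
  finally have "2 * N.prob (E s) = 1 / p"
    using prob_dominant_lin[OF I \<sigma> orth k] by (simp add: D_def)
  then show ?thesis using k by (simp add: E_def D_def field_simps)
qed

text \<open>A form with unit coefficient vector has the law of a single noise coordinate. Scaling by
  \<open>- 1 / \<sigma>\<close> makes it standard normal and turns the upper tail into the lower
  tail that \<open>Phi\<close> measures; strict and weak inequality differ by a null set.\<close>

lemma Phi_eq_prob_lin:
  assumes I: "finite I" and \<sigma>: "\<sigma> > 0" and a: "lin I a a = 1"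
  shows "measure (gauss_vec I \<sigma>) {x \<in> space (gauss_vec I \<sigma>). - b < lin I a x} = Phi (b / \<sigma>)"
proof -
  let ?N = "gauss_vec I \<sigma>"
  interpret N: prob_space ?N using prob_space_gauss[OF \<sigma>] by (intro prob_space_PiM)
  have "distributed ?N lborel (lin I a) (normal_density 0 \<sigma>)"
    using distributed_lin[OF I \<sigma>, of a] a by simp
  from N.normal_density_affine[OF this \<sigma>, of "- 1 / \<sigma>" 0] \<sigma>
  have D: "distributed ?N lborel (\<lambda>x. - lin I a x / \<sigma>) std_normal_density" by simp
  have "AE y in distr ?N lborel (\<lambda>x. - lin I a x / \<sigma>). y \<noteq> b / \<sigma>"
    unfolding distributed_distr_eq_density[OF D]
    using AE_lborel_singleton[of "b / \<sigma>"] by (subst AE_density) auto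
  then have ae: "AE x in ?N. - lin I a x / \<sigma> \<noteq> b / \<sigma>"
    by (rule AE_distrD[OF distributed_measurable[OF D]])
  have "Phi (b / \<sigma>) = measure (distr ?N lborel (\<lambda>x. - lin I a x / \<sigma>)) {..b / \<sigma>}"
    unfolding Phi_def distributed_distr_eq_density[OF D] ..
  also have "\<dots> = N.prob {x \<in> space ?N. - lin I a x / \<sigma> \<le> b / \<sigma>}"
    by (subst measure_distr[OF distributed_measurable[OF D]]) (auto intro!: arg_cong[where f=N.prob])
  also have "\<dots> = N.prob {x \<in> space ?N. - b < lin I a x}"
    using ae \<sigma> by (intro N.prob_eq_AE) (auto simp: field_simps elim!: eventually_mono)
  finally show ?thesis by simp
qed

section \<open>Application to the Lasso losses\<close>

lemma zvec_eq:
  assumes "0 < p" "j < p" and X: "\<And>j k. j < p \<Longrightarrow> k < p \<Longrightarrow> (\<Sum>i<n. X i j * X i k) = (if j = k then 1 else 0)"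
  shows "zvec X n p b1 eps j = (if j = 0 then b1 else 0) + lin {..<n} (\<lambda>i. X i j) eps"
proof -
  have "(\<Sum>k<p. X i k * beta0 b1 k) = X i 0 * b1" for i
    using assms(1) by (simp add: beta0_def if_distrib[of "(*) _"] cong: if_cong)
  then have "zvec X n p b1 eps j = (\<Sum>i<n. X i j * X i 0) * b1 + lin {..<n} (\<lambda>i. X i j) eps"
    by (simp add: zvec_def yvec_def lin_def algebra_simps sum.distrib sum_distrib_left)
  then show ?thesis using assms by simp
qed

theorem theorem2p2:
  fixes n p :: nat and X :: "nat \<Rightarrow> nat \<Rightarrow> real" and b1 \<sigma> :: real
  assumes "1 < p" and "p \<le> n"
    and "\<forall>j<p. \<forall>k<p. (\<Sum>i<n. X i j * X i k) = (if j = k then 1 else 0)"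
    and "b1 \<noteq> 0" and "\<sigma> > 0"
  shows "\<P>(eps in noise n \<sigma>.
            min_loss_p n p b1 (zvec X n p b1 eps) > min_loss_1 n b1 (zvec X n p b1 eps)
          \<bar> sgn (zvec X n p b1 eps 0) = sgn b1)
         = 1 - 1 / (2 * real p * Phi (\<bar>b1\<bar> / \<sigma>))"
proof -
  let ?I = "{..<n}"
  let ?N = "gauss_vec ?I \<sigma>"
  have N: "noise n \<sigma> = ?N" by (simp add: noise_def gauss_def)
  interpret N: prob_space ?N using prob_space_gauss[OF \<open>\<sigma> > 0\<close>] by (intro prob_space_PiM)
  define w where "w j x = lin ?I (\<lambda>i. X i j) x" for j x
  have [measurable]: "w j \<in> borel_measurable (PiM ?I (\<lambda>_. borel))" for j by (simp add: w_def[abs_def])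
  have orth: "lin ?I (\<lambda>i. X i j) (\<lambda>i. X i k) = (if j = k then 1 else 0)" if "j < p" "k < p" for j k
    using assms(3) that by (simp add: lin_def)
  \<comment> \<open>Multiplying by \<open>s\<close> reduces both signs of \<open>b1\<close> to the
    positive case.\<close>
  define s where "s = sgn b1"
  have s: "s * s = 1" "s \<noteq> 0" "b1 = s * \<bar>b1\<bar>" "\<bar>s\<bar> = 1"
    using assms(4) by (auto simp: s_def sgn_if)
  define P where "P x \<longleftrightarrow> min_loss_1 n b1 (zvec X n p b1 x) < min_loss_p n p b1 (zvec X n p b1 x)" for x
  \<comment> \<open>The conditioning event in terms of the noise. The inequality is strict because
    at equality \<open>z\<^sub>0 = 0\<close>, whose sign 0 differs from that of
    \<open>b1\<close>.\<close>
  define Q where "Q x \<longleftrightarrow> - \<bar>b1\<bar> < s * w 0 x" for x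
  have Q_iff: "sgn (zvec X n p b1 x 0) = sgn b1 \<longleftrightarrow> Q x" for x
    using assms by (subst zvec_eq) (auto simp: Q_def s_def w_def sgn_if abs_if split: if_splits)
  define B where "B x \<longleftrightarrow> (\<forall>j\<in>{1..<p}. \<bar>w j x\<bar> \<le> max (s * w 0 x) 0)" for x
  have P_iff: "P x \<longleftrightarrow> \<not> B x" if "Q x" for x
  proof -
    have "zvec X n p b1 x 0 = s * (\<bar>b1\<bar> + s * w 0 x)"
      using assms s by (subst zvec_eq) (auto simp: w_def algebra_simps mult.assoc[symmetric])
    then have "\<bar>zvec X n p b1 x 0\<bar> - \<bar>b1\<bar> = s * w 0 x"
      using that s by (simp add: abs_mult Q_def)
    moreover have "zvec X n p b1 x j = w j x" if "j \<in> {1..<p}" for j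
      using assms that by (subst zvec_eq) (auto simp: w_def)
    ultimately show ?thesis
      using min_loss_p_gt_min_loss_1_iff[of n b1 "zvec X n p b1 x" p] that assms
      by (simp add: P_def B_def Q_iff)
  qed
  have [measurable]: "Measurable.pred ?N Q" "Measurable.pred ?N B"
    unfolding Q_def[abs_def] B_def[abs_def] by measurable
  \<comment> \<open>If \<open>s * w 0 x\<close> is negative, \<open>B\<close> forces
    \<open>w 1 x = 0\<close>; hence almost surely \<open>B\<close> fails there. Index 1 is available
    because \<open>1 < p\<close>.\<close>
  have "AE x in ?N. w 1 x \<noteq> 0"
    unfolding w_def using assms by (intro AE_lin_neq_0) (auto simp: orth)
  then have "AE x in ?N. Q x \<and> B x \<longleftrightarrow> 0 \<le> s * w 0 x \<and> (\<forall>j<p. \<bar>w j x\<bar> \<le> \<bar>w 0 x\<bar>)"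
  proof eventually_elim
    case (elim x)
    show ?case
    proof (cases "0 \<le> s * w 0 x")
      case True
      then have "\<bar>w 0 x\<bar> = s * w 0 x" using s abs_mult[of s "w 0 x"] by simp
      moreover have "Q x" using True assms(4) by (simp add: Q_def)
      moreover have "(\<forall>j<p. \<bar>w j x\<bar> \<le> \<bar>w 0 x\<bar>) \<longleftrightarrow> (\<forall>j\<in>{1..<p}. \<bar>w j x\<bar> \<le> \<bar>w 0 x\<bar>)"
        by (auto simp: Suc_le_eq)
      ultimately show ?thesis using True by (simp add: B_def)
    next
      case False
      then show ?thesis using elim assms(1) by (auto simp: B_def intro!: bexI[of _ 1])
    qed
  qed
  then have "N.prob {x \<in> space ?N. Q x \<and> B x}
      = N.prob {x \<in> space ?N. 0 \<le> s * w 0 x \<and> (\<forall>j<p. \<bar>w j x\<bar> \<le> \<bar>w 0 x\<bar>)}"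
    by (intro N.prob_eq_AE) auto
  also have "\<dots> = 1 / (2 * p)"
    unfolding w_def using assms s by (intro prob_dominant_lin_signed orth) auto
  finally have QB: "N.prob {x \<in> space ?N. Q x \<and> B x} = 1 / (2 * p)" .
  \<comment> \<open>The sign is moved into the coefficient vector, which keeps unit norm since
    \<open>s * s = 1\<close>.\<close>
  have "{x \<in> space ?N. Q x} = {x \<in> space ?N. - \<bar>b1\<bar> < lin ?I (\<lambda>i. s * X i 0) x}"
    by (simp add: Q_def w_def lin_def sum_distrib_left mult.assoc)
  moreover have "lin ?I (\<lambda>i. s * X i 0) (\<lambda>i. s * X i 0) = s * s * lin ?I (\<lambda>i. X i 0) (\<lambda>i. X i 0)"
    by (simp add: lin_def sum_distrib_left mult_ac)
  ultimately have PQ: "N.prob {x \<in> space ?N. Q x} = Phi (\<bar>b1\<bar> / \<sigma>)"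
    using Phi_eq_prob_lin[of ?I \<sigma> "\<lambda>i. s * X i 0" "\<bar>b1\<bar>"] orth s assms by simp
  have "{x \<in> space ?N. P x \<and> Q x} = {x \<in> space ?N. Q x} - {x \<in> space ?N. Q x \<and> B x}"
    using P_iff by auto
  moreover have "N.prob ({x \<in> space ?N. Q x} - {x \<in> space ?N. Q x \<and> B x})
      = N.prob {x \<in> space ?N. Q x} - N.prob {x \<in> space ?N. Q x \<and> B x}"
    by (intro N.finite_measure_Diff) auto
  ultimately have "N.prob {x \<in> space ?N. P x \<and> Q x} = Phi (\<bar>b1\<bar> / \<sigma>) - 1 / (2 * p)"
    by (simp add: QB PQ)
  \<comment> \<open>Needed to divide by the probability of the condition; it follows since the
    condition contains an event of probability \<open>1 / (2 * p)\<close>.\<close>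
  moreover have "Phi (\<bar>b1\<bar> / \<sigma>) > 0"
  proof -
    have "0 < N.prob {x \<in> space ?N. Q x \<and> B x}" using assms QB by simp
    also have "\<dots> \<le> N.prob {x \<in> space ?N. Q x}" by (intro N.finite_measure_mono) auto
    finally show ?thesis by (simp add: PQ)
  qed
  ultimately show ?thesis
    using assms(1) unfolding N cond_prob_def Q_iff P_def[symmetric] PQ
    by (simp add: field_simps)
qed

end
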